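(* Let $\beta = \beta_{i_1} * \beta_{i_2} * \cdots * \beta_{i_\ell}$ be a Dirichlet convolution of functions $\beta_j = \chi_{N_j}$, where $\chi_{N_j}$ denotes the characteristic function of the interval $[N_j, (1+\rho)N_j)$ with $\rho = X^{-\varpi}$, $\varpi = 1/1168$, and let $N = N_{i_1} N_{i_2} \cdots N_{i_\ell}$ satisfy $X^{3/8+8\varpi} < N \ll X^{1/2}$. Assume $R \le X^{-\varpi/6} N$. Then for any $q \ge 1$ we have \begin{equation*} \sum_{r\sim R}\ \sum_{\substack{\ell=1\\ (\ell,r)=1}}^{r} \left( \sum_{\substack{n\equiv \ell \ (\mathrm{mod}\ r)\\ (n,q)=1}} \beta(n) - \frac{1}{\varphi(r)} \sum_{(n,qr)=1} \beta(n) \right)^2 \ll \tau(q)^B N^2 X^{-\frac{\varpi}{12}}. \end{equation*}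
   Context: Here $X$ is a large real number, $r\sim R$ means $R\le r<2R$, $\tau$ is the divisor function, $\varphi$ is Euler's totient function, and $B$ denotes some positive constant. The inner sum over $\ell$ runs over reduced residue classes modulo $r$. *)

theory Defs
  imports "HOL-Analysis.Infinite_Sum" "HOL-Number_Theory.Totient" "HOL-Number_Theory.Cong"
begin

definition varpi :: real where
  "varpi = 1 / 1168"

definition divisor_tau :: "nat \<Rightarrow> nat" where
  "divisor_tau n = card {d. d dvd n}"

text \<open>Arithmetic functions are used on positive arguments only; at \<open>n = 0\<close> the index set below is
  infinite, so the value there is \<open>0\<close>.\<close>

definition dconv :: "(nat \<Rightarrow> real) \<Rightarrow> (nat \<Rightarrow> real) \<Rightarrow> nat \<Rightarrow> real" where
  "dconv f g n = (\<Sum>d | d dvd n. f d * g (n div d))"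

definition dconv_unit :: "nat \<Rightarrow> real" where
  "dconv_unit n = (if n = 1 then 1 else 0)"

definition dconv_list :: "(nat \<Rightarrow> real) list \<Rightarrow> nat \<Rightarrow> real" where
  "dconv_list fs = foldr dconv fs dconv_unit"

definition interval_char :: "real \<Rightarrow> real \<Rightarrow> nat \<Rightarrow> real" where
  "interval_char \<rho> M = (\<lambda>n. indicator {M..<(1 + \<rho>) * M} (real n))"

definition dyadic :: "real \<Rightarrow> nat set" where
  "dyadic R = {r. R \<le> real r \<and> real r < 2 * R}"

text \<open>The sums over \<open>n\<close> range over all positive integers; they are applied to finitely
  supported \<open>\<beta>\<close>, so the infinite sums below are in fact finite.\<close>

definition discrepancy :: "(nat \<Rightarrow> real) \<Rightarrow> nat \<Rightarrow> nat \<Rightarrow> nat \<Rightarrow> real" where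
  "discrepancy \<beta> q r a =
     (\<Sum>\<^sub>\<infinity>n | 0 < n \<and> [n = a] (mod r) \<and> coprime n q. \<beta> n)
     - 1 / real (totient r) * (\<Sum>\<^sub>\<infinity>n | 0 < n \<and> coprime n (q * r). \<beta> n)"

end

theory Submission
  imports Defs
begin

text \<open>Each interval has relative length \<open>\<rho> = X\<^bsup>-\<varpi>\<^esup>\<close>, so the total mass \<open>S\<close> of \<open>\<beta>\<close> is already
  \<open>O(X\<^bsup>-\<varpi>\<^esup> N)\<close> and no large sieve is needed.  The inner sum over residue classes is a variance,
  hence at most the sum of \<open>\<beta>(n) \<beta>(m)\<close> over \<open>n \<equiv> m (mod r)\<close>.  Summing over \<open>r \<sim> R\<close>, the diagonal
  contributes at most \<open>2 R S max \<beta>\<close>, and each pair \<open>n \<noteq> m\<close> is counted at most \<open>\<tau>(|n - m|)\<close> times.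
  The divisor bound then gives \<open>O(X\<^bsup>\<varpi>/2\<^esup> (R S + S\<^sup>2))\<close>, with \<open>B = 1\<close>.\<close>

section \<open>The divisor bound\<close>

lemma divisor_tau_pos: "0 < divisor_tau n" if "0 < n"
  unfolding divisor_tau_def using that by (subst card_gt_0_iff) auto

lemma divisor_tau_mono: "divisor_tau m \<le> divisor_tau n" if "m dvd n" "0 < n"
  unfolding divisor_tau_def using that by (intro card_mono) (auto intro: dvd_trans)

text \<open>A divisor of a product splits into a divisor of each factor, so multiplication maps
  pairs of divisors onto the divisors of the product. Coprimality would give equality, but the
  divisor bound needs only this direction.\<close>

lemma divisor_tau_mult_le: "divisor_tau (a * b) \<le> divisor_tau a * divisor_tau b" if "0 < a" "0 < b"
proof -
  have "{d. d dvd a * b} \<subseteq> (\<lambda>(x, y). x * y) ` ({d. d dvd a} \<times> {d. d dvd b})"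
  proof
    fix d assume "d \<in> {d. d dvd a * b}"
    then obtain x y where "d = x * y" "x dvd a" "y dvd b"
      using division_decomp[of d a b] by auto
    then show "d \<in> (\<lambda>(x, y). x * y) ` ({d. d dvd a} \<times> {d. d dvd b})"
      by (intro image_eqI[of _ _ "(x, y)"]) auto
  qed
  then have "card {d. d dvd a * b} \<le> card ({d. d dvd a} \<times> {d. d dvd b})"
    using that by (intro surj_card_le) auto
  then show ?thesis
    by (simp add: divisor_tau_def card_cartesian_product)
qed

lemma divisor_tau_prod_le:
  assumes "finite A" "\<And>x. x \<in> A \<Longrightarrow> 0 < f x"
  shows "divisor_tau (\<Prod>x\<in>A. f x) \<le> (\<Prod>x\<in>A. divisor_tau (f x))"
  using assms
proof (induction A rule: finite_induct)
  case empty
  then show ?case by (simp add: divisor_tau_def)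
next
  case (insert x A)
  have "divisor_tau (f x * (\<Prod>x\<in>A. f x)) \<le> divisor_tau (f x) * divisor_tau (\<Prod>x\<in>A. f x)"
    using insert.prems by (intro divisor_tau_mult_le) (auto simp: prod_pos)
  also have "\<dots> \<le> divisor_tau (f x) * (\<Prod>x\<in>A. divisor_tau (f x))"
    using insert by (intro mult_left_mono) auto
  finally show ?case
    using insert.hyps by simp
qed

lemma divisor_tau_prime_power_le: "divisor_tau (p ^ a) \<le> Suc a" if "prime p"
proof -
  have "{d. d dvd p ^ a} \<subseteq> (\<lambda>i. p ^ i) ` {..a}"
    using divides_primepow_nat[OF that] by auto
  then have "card {d. d dvd p ^ a} \<le> card {..a}"
    by (intro surj_card_le) auto
  then show ?thesis
    by (simp add: divisor_tau_def)
qed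

text \<open>This is the local factor of the divisor bound. If \<open>p powr e\<close> is at least 2,
  then p^(a e) >= 2^a >= a + 1 and no constant is lost. For smaller p, e ln 2 <= 1 and ln 2 <= ln p
  give e ln 2 (a + 1) <= 1 + e a ln p <= exp (e a ln p).\<close>

lemma Suc_le_prime_powr:
  fixes e :: real and p :: nat
  assumes "0 < e" "e \<le> 1" "prime p"
  shows "real (Suc a) \<le> (if p powr e < 2 then 1 / (e * ln 2) else 1) * real (p ^ a) powr e"
proof -
  have p: "2 \<le> real p"
    using prime_ge_2_nat[OF assms(3)] by simp
  have eq: "real (p ^ a) powr e = exp (e * a * ln p)"
    using p by (simp add: powr_def ln_realpow)
  have eq': "real (p ^ a) powr e = (p powr e) ^ a"
    using p by (simp add: powr_power powr_realpow[symmetric] powr_powr mult.commute)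
  show ?thesis
  proof (cases "p powr e < 2")
    case True
    have ln2: "0 < ln (2::real)" "ln (2::real) \<le> 1"
      using ln_2_less_1 by auto
    have "e * ln 2 * Suc a = e * ln 2 + e * a * ln 2"
      by (simp add: algebra_simps)
    also have "\<dots> \<le> 1 + e * a * ln p"
      using assms(1,2) p ln2 by (intro add_mono mult_left_mono mult_le_one) auto
    also have "\<dots> \<le> real (p ^ a) powr e"
      unfolding eq by (rule exp_ge_add_one_self)
    finally show ?thesis
      using True assms(1) ln2 by (simp add: field_simps)
  next
    case False
    have "real (Suc a) \<le> 2 ^ a"
      by (metis Suc_leI less_exp of_nat_le_iff of_nat_numeral of_nat_power)
    also have "\<dots> \<le> (p powr e) ^ a"
      using False by (intro power_mono) auto
    finally show ?thesis
      using False eq' by simp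
  qed
qed

text \<open>By submultiplicativity it suffices to multiply the local bounds over the prime powers of
  n. Only bases p < 2^(1/e) cost a constant, and there are finitely many of them, so the total loss
  is bounded independently of n.\<close>

lemma divisor_bound:
  fixes e :: real
  assumes e: "0 < e" "e \<le> 1"
  obtains C where "1 \<le> C" "\<And>n. 0 < n \<Longrightarrow> real (divisor_tau n) \<le> C * n powr e"
proof
  \<comment> \<open>\<open>P\<close> collects all small naturals, not just primes: only its
    finiteness matters, and \<open>c ^ card P\<close> is the witness for C.\<close>
  define P where "P = {p::nat. p powr e < 2}"
  define c where "c = 1 / (e * ln 2)"
  have c: "1 \<le> c"
    using e ln_2_less_1 by (auto simp: c_def field_simps intro!: mult_le_one)
  have "P \<subseteq> {..nat \<lceil>2 powr (1 / e)\<rceil>}"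
  proof
    fix p assume "p \<in> P"
    then have "(p powr e) powr (1 / e) \<le> 2 powr (1 / e)"
      using e by (intro powr_mono2) (auto simp: P_def)
    then have "real p \<le> 2 powr (1 / e)"
      using e by (simp add: powr_powr)
    then show "p \<in> {..nat \<lceil>2 powr (1 / e)\<rceil>}"
      by (simp add: le_nat_iff) linarith
  qed
  then have fin: "finite P"
    using finite_subset by blast
  show "1 \<le> c ^ card P"
    using c by (rule one_le_power)
  fix n :: nat assume n: "0 < n"
  let ?F = "prime_factors n"
  let ?f = "\<lambda>p. p ^ multiplicity p n"
  have n_eq: "(\<Prod>p\<in>?F. ?f p) = n"
    using n by (simp add: prod_prime_factors)
  have "real (divisor_tau n) = real (divisor_tau (\<Prod>p\<in>?F. ?f p))"
    by (simp only: n_eq)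
  also have "\<dots> \<le> (\<Prod>p\<in>?F. real (divisor_tau (?f p)))"
    unfolding of_nat_prod[symmetric] of_nat_le_iff
    by (intro divisor_tau_prod_le) (auto simp: prime_gt_0_nat in_prime_factors_iff)
  also have "\<dots> \<le> (\<Prod>p\<in>?F. (if p \<in> P then c else 1) * real (?f p) powr e)"
  proof (intro prod_mono conjI)
    fix p assume "p \<in> ?F"
    then have "prime p" by auto
    then show "real (divisor_tau (?f p)) \<le> (if p \<in> P then c else 1) * real (?f p) powr e"
      using divisor_tau_prime_power_le[of p "multiplicity p n"]
        Suc_le_prime_powr[OF e, of p "multiplicity p n"]
      unfolding P_def c_def mem_Collect_eq by linarith
  qed auto
  also have "\<dots> = (\<Prod>p\<in>?F. if p \<in> P then c else 1) * (\<Prod>p\<in>?F. real (?f p) powr e)"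
    by (rule prod.distrib)
  also have "(\<Prod>p\<in>?F. real (?f p) powr e) = n powr e"
    by (subst (2) n_eq[symmetric]) (simp add: prod_powr_distrib)
  also have "(\<Prod>p\<in>?F. if p \<in> P then c else 1) = c ^ card (?F \<inter> P)"
    by (simp add: prod.If_cases Int_def)
  also have "c ^ card (?F \<inter> P) \<le> c ^ card P"
    using c fin by (intro power_increasing card_mono) auto
  finally show "real (divisor_tau n) \<le> c ^ card P * n powr e"
    by (simp add: mult_right_mono)
qed

section \<open>Dirichlet convolutions of nonnegative functions\<close>

lemma dconv_list_Nil: "dconv_list [] = dconv_unit"
  by (simp add: dconv_list_def)

lemma dconv_list_Cons: "dconv_list (f # fs) = dconv f (dconv_list fs)"
  by (simp add: dconv_list_def)

lemma dconv_list_nonneg: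
  assumes "\<And>f n. f \<in> set fs \<Longrightarrow> 0 \<le> f n"
  shows "0 \<le> dconv_list fs n"
  using assms
  by (induction fs arbitrary: n)
     (auto simp: dconv_list_Nil dconv_list_Cons dconv_unit_def dconv_def intro!: sum_nonneg)

text \<open>Each further convolution sums over the divisors d of n, and every summand is at most the
  bound for n/d, which divides n. Hence each function in the list costs one factor tau(n).\<close>

lemma dconv_list_le_divisor_tau_power:
  assumes "\<And>f n. f \<in> set fs \<Longrightarrow> 0 \<le> f n \<and> f n \<le> 1" "0 < n"
  shows "dconv_list fs n \<le> real (divisor_tau n) ^ length fs"
  using assms
proof (induction fs arbitrary: n)
  case Nil
  then show ?case by (simp add: dconv_list_Nil dconv_unit_def)
next
  case (Cons f fs)
  have "dconv_list (f # fs) n \<le> (\<Sum>d | d dvd n. real (divisor_tau n) ^ length fs)"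
    unfolding dconv_list_Cons dconv_def
  proof (rule sum_mono)
    fix d assume "d \<in> {d. d dvd n}"
    then have d: "d dvd n" by simp
    have pos: "0 < n div d" and dvd: "n div d dvd n"
      using d Cons.prems(2) by (auto simp: dvd_div_eq_0_iff elim: dvdE)
    have "f d * dconv_list fs (n div d) \<le> 1 * dconv_list fs (n div d)"
      using Cons.prems(1) by (intro mult_right_mono dconv_list_nonneg) auto
    also have "\<dots> \<le> real (divisor_tau (n div d)) ^ length fs"
      using Cons.IH[OF _ pos] Cons.prems(1) by simp
    also have "\<dots> \<le> real (divisor_tau n) ^ length fs"
      using divisor_tau_mono[OF dvd Cons.prems(2)] by (intro power_mono) auto
    finally show "f d * dconv_list fs (n div d) \<le> real (divisor_tau n) ^ length fs" .
  qed
  then show ?case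
    by (simp add: divisor_tau_def)
qed

text \<open>The map (n, d) to (d, n/d) embeds the pairs with d dividing n into the box {1..Y} x
  {1..Y}. Nonnegativity allows the sum to be extended to the whole box, where it factors.\<close>

lemma sum_dconv_le:
  assumes "\<And>n. 0 \<le> f n" "\<And>n. 0 \<le> g n"
  shows "(\<Sum>n\<in>{1..Y}. dconv f g n) \<le> (\<Sum>n\<in>{1..Y}. f n) * (\<Sum>n\<in>{1..Y}. g n)"
proof -
  let ?D = "SIGMA n:{1..Y}. {d. d dvd n}"
  let ?\<pi> = "\<lambda>(n::nat, d). (d, n div d)"
  have inj: "inj_on ?\<pi> ?D"
    by (rule inj_onI) (auto elim!: dvdE)
  have "?\<pi> ` ?D \<subseteq> {1..Y} \<times> {1..Y}"
  proof clarsimp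
    fix n d :: nat assume *: "Suc 0 \<le> n" "n \<le> Y" "d dvd n"
    then have "0 < n div d" "0 < d" "d \<le> n"
      by (auto simp: dvd_div_eq_0_iff dvd_imp_le elim: dvdE)
    moreover have "n div d \<le> Y"
      using div_le_dividend[of n d] *(2) by (rule le_trans)
    ultimately show "Suc 0 \<le> d \<and> d \<le> Y \<and> Suc 0 \<le> n div d \<and> n div d \<le> Y"
      using * by simp
  qed
  then have "(\<Sum>(d, e)\<in>?\<pi> ` ?D. f d * g e) \<le> (\<Sum>(d, e)\<in>{1..Y} \<times> {1..Y}. f d * g e)"
    using assms by (intro sum_mono2) auto
  moreover have "(\<Sum>n\<in>{1..Y}. dconv f g n) = (\<Sum>(n, d)\<in>?D. f d * g (n div d))"
    unfolding dconv_def by (subst sum.Sigma) auto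
  moreover have "\<dots> = (\<Sum>(d, e)\<in>?\<pi> ` ?D. f d * g e)"
    by (subst sum.reindex[OF inj]) (auto intro!: sum.cong)
  ultimately show ?thesis
    by (simp add: sum_product sum.cartesian_product)
qed

lemma sum_dconv_list_le:
  assumes "\<And>f n. f \<in> set fs \<Longrightarrow> 0 \<le> f n"
  shows "(\<Sum>n\<in>{1..Y}. dconv_list fs n) \<le> (\<Prod>f\<leftarrow>fs. \<Sum>n\<in>{1..Y}. f n)"
  using assms
proof (induction fs)
  case Nil
  \<comment> \<open>The sum is 1 or, for Y = 0, empty; either way it is at most the empty
    product.\<close>
  have "(\<Sum>n\<in>{1..Y}. dconv_list [] n) = (\<Sum>n\<in>{1..Y} \<inter> {1}. 1::real)"
    by (auto simp: dconv_list_Nil dconv_unit_def sum.If_cases intro!: sum.mono_neutral_cong_right)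
  also have "\<dots> \<le> 1" by (auto simp: card_le_Suc0_iff_eq)
  finally show ?case by simp
next
  case (Cons f fs)
  have "(\<Sum>n\<in>{1..Y}. dconv_list (f # fs) n) \<le> (\<Sum>n\<in>{1..Y}. f n) * (\<Sum>n\<in>{1..Y}. dconv_list fs n)"
    unfolding dconv_list_Cons using Cons.prems by (intro sum_dconv_le dconv_list_nonneg) auto
  also have "\<dots> \<le> (\<Sum>n\<in>{1..Y}. f n) * (\<Prod>f\<leftarrow>fs. \<Sum>n\<in>{1..Y}. f n)"
    using Cons by (intro mult_left_mono sum_nonneg) auto
  finally show ?case by simp
qed

section \<open>Convolutions of short intervals\<close>

lemma interval_char_bounds: "0 \<le> interval_char \<rho> M n" "interval_char \<rho> M n \<le> 1"
  by (auto simp: interval_char_def indicator_def)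

text \<open>A nonzero value forces n to be a product of one integer from each interval, and each of
  these is below (1 + \<open>\<rho>\<close>) M <= 2 M.\<close>

lemma dconv_list_interval_char_support:
  assumes "\<rho> \<le> 1" "\<And>M. M \<in> set Ms \<Longrightarrow> 0 < M" "0 < n"
    "dconv_list (map (interval_char \<rho>) Ms) n \<noteq> 0"
  shows "real n \<le> 2 ^ length Ms * prod_list Ms"
  using assms
proof (induction Ms arbitrary: n)
  case Nil
  then show ?case by (auto simp: dconv_list_Nil dconv_unit_def split: if_splits)
next
  case (Cons M Ms)
  from Cons.prems(4) obtain d where d: "d dvd n" "interval_char \<rho> M d \<noteq> 0"
      "dconv_list (map (interval_char \<rho>) Ms) (n div d) \<noteq> 0"
    by (auto simp: dconv_list_Cons dconv_def elim!: sum.not_neutral_contains_not_neutral)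
  have M: "0 < M" using Cons.prems(2) by simp
  have "real d < (1 + \<rho>) * M"
    using d(2) by (auto simp: interval_char_def indicator_def split: if_splits)
  also have "\<dots> \<le> 2 * M"
    using M Cons.prems(1) by (intro mult_right_mono) auto
  finally have d_le: "real d \<le> 2 * M" by simp
  have "0 < n div d"
    using d(1) Cons.prems(3) by (auto simp: dvd_div_eq_0_iff elim: dvdE)
  then have "real (n div d) \<le> 2 ^ length Ms * prod_list Ms"
    using Cons.prems d by (intro Cons.IH) auto
  then have "real d * real (n div d) \<le> (2 * M) * (2 ^ length Ms * prod_list Ms)"
    using d_le M by (intro mult_mono) auto
  then show ?case
    using d(1) by (simp flip: of_nat_mult add: mult_ac)
qed

lemma sum_interval_char_le:
  assumes "0 < M" "0 < \<rho>"
  shows "(\<Sum>n\<in>{1..Y}. interval_char \<rho> M n) \<le> \<rho> * M + 1"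
proof -
  let ?A = "{n \<in> {1..Y}. M \<le> real n \<and> real n < (1 + \<rho>) * M}"
  have "(\<Sum>n\<in>{1..Y}. interval_char \<rho> M n) = real (card ?A)"
    by (simp add: interval_char_def indicator_def sum.If_cases Int_def)
  also have "real (card ?A) \<le> \<rho> * M + 1"
  proof (cases "?A = {}")
    case False
    define a where "a = Min ?A"
    define b where "b = Max ?A"
    have "a \<in> ?A" "b \<in> ?A"
      using False unfolding a_def b_def by (intro Min_in Max_in; simp)+
    have "?A \<subseteq> {a..b}"
      unfolding a_def b_def by auto
    then have "card ?A \<le> card {a..b}"
      by (intro card_mono) auto
    then have "real (card ?A) \<le> real b - real a + 1"
      using \<open>a \<in> ?A\<close> \<open>?A \<subseteq> {a..b}\<close> by auto
    also have "\<dots> \<le> \<rho> * M + 1"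
      using \<open>a \<in> ?A\<close> \<open>b \<in> ?A\<close> by (auto simp: algebra_simps)
    finally show ?thesis .
  next
    case True
    then show ?thesis using assms by (simp only: card.empty) simp
  qed
  finally show ?thesis .
qed

text \<open>This absorbs the additive 1 of the counting bound even for small M: if M < 1/2 the
  interval contains no positive integer, and otherwise 1 <= 2 M.\<close>

lemma sum_interval_char_le_triple:
  assumes "0 < M" "0 < \<rho>" "\<rho> \<le> 1"
  shows "(\<Sum>n\<in>{1..Y}. interval_char \<rho> M n) \<le> 3 * M"
proof (cases "M < 1 / 2")
  case True
  have "interval_char \<rho> M n = 0" if "n \<in> {1..Y}" for n
  proof -
    have "(1 + \<rho>) * M \<le> 2 * M"
      using assms by (intro mult_right_mono) auto
    with True that have "(1 + \<rho>) * M < real n" by simp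
    then show ?thesis by (simp add: interval_char_def)
  qed
  then show ?thesis using assms by simp
next
  case False
  have "\<rho> * M \<le> 1 * M" using assms by (intro mult_right_mono) auto
  with False sum_interval_char_le[OF assms(1,2), of Y] show ?thesis by linarith
qed

text \<open>An interval with \<open>\<rho> M < 1\<close> contains at most two integers, while a longer one gains a factor \<open>\<rho>\<close>
  over its left endpoint.\<close>

lemma prod_list_sum_interval_char_le:
  assumes "\<And>M. M \<in> set Ms \<Longrightarrow> 0 < M" "0 < \<rho>" "\<rho> \<le> 1" "1 \<le> \<rho> * prod_list Ms"
  shows "(\<Prod>M\<leftarrow>Ms. \<Sum>n\<in>{1..Y}. interval_char \<rho> M n) \<le> 3 ^ length Ms * (\<rho> * prod_list Ms)"
proof -
  let ?c = "\<lambda>M. \<Sum>n\<in>{1..Y}. interval_char \<rho> M n"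
  let ?P = "\<lambda>Ms. \<Prod>M\<leftarrow>Ms. ?c M"
  have c0: "0 \<le> ?c M" for M
    by (intro sum_nonneg interval_char_bounds)
  have P0: "0 \<le> ?P Ms" for Ms
    using c0 by (induction Ms) auto
  \<comment> \<open>The induction carries the trivial bound along with a dichotomy: either some
    interval is long and has supplied one factor \<open>\<rho>\<close>, or all are short and the
    product is at most 3^length. The trivial bound serves for the remaining factors once a long
    interval is met.\<close>
  have "?P Ms \<le> 3 ^ length Ms * prod_list Ms \<and> 0 \<le> prod_list Ms \<and>
        (?P Ms \<le> 3 ^ length Ms * (\<rho> * prod_list Ms) \<or> ?P Ms \<le> 3 ^ length Ms)"
    using assms(1)
  proof (induction Ms)
    case (Cons M Ms)
    have M: "0 < M" using Cons.prems by simp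
    have IH: "?P Ms \<le> 3 ^ length Ms * prod_list Ms" "0 \<le> prod_list Ms"
        "?P Ms \<le> 3 ^ length Ms * (\<rho> * prod_list Ms) \<or> ?P Ms \<le> 3 ^ length Ms"
      using Cons by auto
    note c3 = sum_interval_char_le_triple[OF M assms(2,3), of Y]
    have 1: "?c M * ?P Ms \<le> (3 * M) * (3 ^ length Ms * prod_list Ms)"
      using c3 IH(1) P0 M by (intro mult_mono) auto
    have 2: "?c M * ?P Ms \<le> 3 ^ length (M # Ms) * (\<rho> * prod_list (M # Ms)) \<or>
             ?c M * ?P Ms \<le> 3 ^ length (M # Ms)"
    proof (cases "1 \<le> \<rho> * M")
      case True
      then have "?c M \<le> 3 * (\<rho> * M)"
        using sum_interval_char_le[OF M assms(2), of Y] by linarith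
      then have "?c M * ?P Ms \<le> (3 * (\<rho> * M)) * (3 ^ length Ms * prod_list Ms)"
        using IH(1) P0 M assms(2) by (intro mult_mono) auto
      then show ?thesis by (simp add: mult_ac)
    next
      case False
      then have c: "?c M \<le> 3"
        using sum_interval_char_le[OF M assms(2), of Y] by linarith
      from IH(3) show ?thesis
      proof
        assume "?P Ms \<le> 3 ^ length Ms * (\<rho> * prod_list Ms)"
        then have "?c M * ?P Ms \<le> (3 * M) * (3 ^ length Ms * (\<rho> * prod_list Ms))"
          using c3 P0 M by (intro mult_mono) auto
        then show ?thesis by (simp add: mult_ac)
      next
        assume "?P Ms \<le> 3 ^ length Ms"
        then have "?c M * ?P Ms \<le> 3 * 3 ^ length Ms"
          using c P0 by (intro mult_mono) auto
        then show ?thesis by simp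
      qed
    qed
    show ?case
      using 1 2 M IH(2) by (simp add: mult_ac)
  qed simp
  \<comment> \<open>The assumption 1 <= \<open>\<rho> * prod_list Ms\<close> absorbs the case where
    all intervals are short.\<close>
  moreover have "(3::real) ^ length Ms \<le> 3 ^ length Ms * (\<rho> * prod_list Ms)"
    using assms(4) by simp
  ultimately show ?thesis by linarith
qed

section \<open>The variance over residue classes\<close>

text \<open>With k = card G, expanding the square leaves a cross term -2 (T/k) (sum of A), at most
  -2 T^2/k, which outweighs the added T^2/k.\<close>

lemma sum_square_deviation_le:
  fixes A :: "'a \<Rightarrow> real"
  assumes "0 \<le> T" "T \<le> (\<Sum>a\<in>G. A a)"
  shows "(\<Sum>a\<in>G. (A a - 1 / real (card G) * T)\<^sup>2) \<le> (\<Sum>a\<in>G. (A a)\<^sup>2)"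
\<comment> \<open>Here G is empty or infinite, and both sums are 0 in either case.\<close>
proof (cases "card G = 0")
  case False
  define k where "k = real (card G)"
  have k: "0 < k" using False by (simp add: k_def)
  have "(\<Sum>a\<in>G. (A a - 1 / k * T)\<^sup>2) = (\<Sum>a\<in>G. (A a)\<^sup>2 - 2 * (T / k) * A a + (T / k)\<^sup>2)"
    by (intro sum.cong) (auto simp: power2_eq_square algebra_simps)
  also have "\<dots> = (\<Sum>a\<in>G. (A a)\<^sup>2) - 2 * (T / k) * (\<Sum>a\<in>G. A a) + k * (T / k)\<^sup>2"
    by (simp add: sum.distrib sum_subtractf sum_distrib_left k_def)
  also have "k * (T / k)\<^sup>2 = (T / k) * T"
    using k by (simp add: power2_eq_square)
  also have "(\<Sum>a\<in>G. (A a)\<^sup>2) - 2 * (T / k) * (\<Sum>a\<in>G. A a) + (T / k) * T \<le> (\<Sum>a\<in>G. (A a)\<^sup>2)"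
  proof -
    have "(T / k) * T \<le> (T / k) * (\<Sum>a\<in>G. A a)" "0 \<le> (T / k) * T"
      using assms k by (auto intro!: divide_right_mono mult_left_mono)
    then show ?thesis by linarith
  qed
  finally show ?thesis by (simp add: k_def)
qed simp

lemma residue_rep_unique:
  assumes "a \<in> {1..r}" "b \<in> {1..r}" "[a = b] (mod r)"
  shows "a = (b::nat)"
proof -
  have "[int a = int b] (mod int r)" using assms(3) by (simp add: cong_int_iff)
  then have "int r dvd int a - int b" by (simp add: cong_iff_dvd_diff)
  moreover have "\<bar>int a - int b\<bar> < int r" using assms(1,2) by auto
  ultimately have "int a - int b = 0"
    using zdvd_not_zless[of "\<bar>int a - int b\<bar>" "int r"] by auto
  then show ?thesis by simp
qed

lemma totient_conv_card: "totient r = card {a. a \<in> {1..r} \<and> coprime a r}"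
  unfolding totient_def totatives_def by (rule arg_cong[where f = card]) auto

lemma infsum_eq_sum_atMost:
  fixes \<beta> :: "nat \<Rightarrow> real"
  assumes "\<And>n. 0 < n \<Longrightarrow> \<beta> n \<noteq> 0 \<Longrightarrow> n \<le> Y"
  shows "(\<Sum>\<^sub>\<infinity>n | 0 < n \<and> P n. \<beta> n) = (\<Sum>n | n \<in> {1..Y} \<and> P n. \<beta> n)"
proof -
  have "(\<Sum>\<^sub>\<infinity>n | 0 < n \<and> P n. \<beta> n) = (\<Sum>\<^sub>\<infinity>n | n \<in> {1..Y} \<and> P n. \<beta> n)"
    using assms by (intro infsum_cong_neutral) force+
  then show ?thesis by simp
qed

lemma sum_discrepancy_squares_le:
  assumes r: "0 < r" and \<beta>0: "\<And>n. 0 \<le> \<beta> n" and supp: "\<And>n. 0 < n \<Longrightarrow> \<beta> n \<noteq> 0 \<Longrightarrow> n \<le> Y"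
  shows "(\<Sum>a | a \<in> {1..r} \<and> coprime a r. (discrepancy \<beta> q r a)\<^sup>2)
       \<le> (\<Sum>n\<in>{1..Y}. \<Sum>m\<in>{1..Y}. \<beta> n * \<beta> m * of_bool ([n = m] (mod r)))"
proof -
  let ?G = "{a. a \<in> {1..r} \<and> coprime a r}"
  define W where "W a = {n. n \<in> {1..Y} \<and> [n = a] (mod r) \<and> coprime n q}" for a
  define A where "A a = sum \<beta> (W a)" for a
  define V where "V = {n. n \<in> {1..Y} \<and> coprime n (q * r)}"
  define T where "T = sum \<beta> V"
  have fin: "finite V" "finite (W a)" for a
    by (auto simp: V_def W_def)
  have infsum: "(\<Sum>\<^sub>\<infinity>n | 0 < n \<and> P n. \<beta> n) = (\<Sum>n | n \<in> {1..Y} \<and> P n. \<beta> n)" for P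
    using supp by (intro infsum_eq_sum_atMost)
  have disc: "discrepancy \<beta> q r a = A a - 1 / real (card ?G) * T" for a
    unfolding discrepancy_def A_def T_def W_def V_def totient_conv_card
    by (simp only: infsum)
  \<comment> \<open>Residues are represented in {1..r}, so a multiple of r is sent to r rather than
    0.\<close>
  define rep where "rep n = (if n mod r = 0 then r else n mod r)" for n
  have rep: "rep n \<in> {1..r}" "[n = rep n] (mod r)" for n
    using r by (auto simp: rep_def cong_def less_imp_le)
  \<comment> \<open>Grouping by residue class shows that the class sums account for all of T, as the
    variance inequality requires.\<close>
  have "T = (\<Sum>a\<in>?G. sum \<beta> {n \<in> V. rep n = a})"
    unfolding T_def
  proof (rule sum.group[symmetric])
    show "rep ` V \<subseteq> ?G"
    proof
      fix a assume "a \<in> rep ` V"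
      then obtain n where n: "n \<in> V" "a = rep n" by auto
      then have "coprime n r" by (auto simp: V_def)
      then have "coprime (rep n) r"
        using cong_imp_coprime[OF rep(2)[of n]] by simp
      with n rep(1) show "a \<in> ?G" by simp
    qed
  qed (use fin in auto)
  also have "\<dots> \<le> (\<Sum>a\<in>?G. A a)"
    unfolding A_def
  proof (intro sum_mono sum_mono2)
    fix a show "{n \<in> V. rep n = a} \<subseteq> W a"
      using rep(2) by (auto simp: V_def W_def)
  qed (use fin \<beta>0 in auto)
  finally have T: "T \<le> (\<Sum>a\<in>?G. A a)" .
  have "0 \<le> T"
    unfolding T_def by (intro sum_nonneg \<beta>0)
  have "(\<Sum>a\<in>?G. (discrepancy \<beta> q r a)\<^sup>2) \<le> (\<Sum>a\<in>?G. (A a)\<^sup>2)"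
    unfolding disc using \<open>0 \<le> T\<close> T by (rule sum_square_deviation_le)
  also have "\<dots> \<le> (\<Sum>a\<in>{1..r}. (A a)\<^sup>2)"
    by (intro sum_mono2) auto
  also have "\<dots> \<le> (\<Sum>a\<in>{1..r}. \<Sum>n\<in>{1..Y}. \<Sum>m\<in>{1..Y}.
      \<beta> n * \<beta> m * of_bool ([n = a] (mod r) \<and> [m = a] (mod r)))"
  proof (rule sum_mono)
    fix a
    have "A a \<le> (\<Sum>n\<in>{1..Y}. \<beta> n * of_bool ([n = a] (mod r)))" (is "_ \<le> ?B")
    proof -
      have "A a = (\<Sum>n\<in>W a. \<beta> n * of_bool ([n = a] (mod r)))"
        unfolding A_def by (intro sum.cong) (auto simp: W_def)
      also have "\<dots> \<le> ?B"
        using \<beta>0 by (intro sum_mono2) (auto simp: W_def)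
      finally show ?thesis .
    qed
    moreover have "0 \<le> A a"
      unfolding A_def by (intro sum_nonneg \<beta>0)
    ultimately have "(A a)\<^sup>2 \<le> ?B\<^sup>2"
      by (intro power_mono)
    also have "?B\<^sup>2 = (\<Sum>n\<in>{1..Y}. \<Sum>m\<in>{1..Y}.
      \<beta> n * \<beta> m * of_bool ([n = a] (mod r) \<and> [m = a] (mod r)))"
      unfolding power2_eq_square sum_product by (intro sum.cong) auto
    finally show "(A a)\<^sup>2 \<le> \<dots>" .
  qed
  also have "\<dots> = (\<Sum>n\<in>{1..Y}. \<Sum>m\<in>{1..Y}. \<beta> n * \<beta> m *
      (\<Sum>a\<in>{1..r}. of_bool ([n = a] (mod r) \<and> [m = a] (mod r))))"
    by (subst sum.swap, rule sum.cong[OF refl], subst sum.swap) (simp only: sum_distrib_left)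
  also have "\<dots> \<le> (\<Sum>n\<in>{1..Y}. \<Sum>m\<in>{1..Y}. \<beta> n * \<beta> m * of_bool ([n = m] (mod r)))"
  proof (intro sum_mono mult_left_mono)
    fix n m
    \<comment> \<open>Only a = \<open>rep n\<close> can be congruent to n, so each pair is counted
      at most once.\<close>
    have "(\<Sum>a\<in>{1..r}. of_bool ([n = a] (mod r) \<and> [m = a] (mod r)) :: real)
        \<le> (\<Sum>a\<in>{1..r}. of_bool ([n = m] (mod r)) * of_bool (a = rep n))"
    proof (rule sum_mono)
      fix a assume a: "a \<in> {1..r}"
      have "[n = m] (mod r) \<and> a = rep n" if "[n = a] (mod r)" "[m = a] (mod r)"
        using that a rep residue_rep_unique[of a r "rep n"] by (meson cong_sym cong_trans)
      then show "of_bool ([n = a] (mod r) \<and> [m = a] (mod r))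
          \<le> (of_bool ([n = m] (mod r)) * of_bool (a = rep n) :: real)"
        by auto
    qed
    also have "\<dots> = of_bool ([n = m] (mod r))"
      unfolding sum_distrib_left[symmetric] using rep(1)[of n]
      by (simp add: of_bool_def)
    finally show "(\<Sum>a\<in>{1..r}. of_bool ([n = a] (mod r) \<and> [m = a] (mod r)))
        \<le> (of_bool ([n = m] (mod r)) :: real)" .
  qed (use \<beta>0 in auto)
  finally show ?thesis .
qed

section \<open>Summation over the moduli in a dyadic range\<close>

lemma finite_dyadic: "finite (dyadic R)"
proof (rule finite_subset)
  show "dyadic R \<subseteq> {..nat \<lceil>2 * R\<rceil>}"
    by (auto simp: dyadic_def) linarith
qed simp

text \<open>Since R > 0 excludes r = 0, counting from 1 up to floor(2 R) gives a bound with no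
  additive term, valid also for R < 1.\<close>

lemma card_dyadic_le: "real (card (dyadic R)) \<le> 2 * R" if "0 < R"
proof -
  have "dyadic R \<subseteq> {1..nat \<lfloor>2 * R\<rfloor>}"
  proof
    fix r assume "r \<in> dyadic R"
    then have "0 < real r" "real r \<le> 2 * R"
      using that by (auto simp: dyadic_def)
    then show "r \<in> {1..nat \<lfloor>2 * R\<rfloor>}"
      by (simp add: le_nat_iff le_floor_iff)
  qed
  then have "card (dyadic R) \<le> nat \<lfloor>2 * R\<rfloor>"
    using card_mono[of "{1..nat \<lfloor>2 * R\<rfloor>}"] by simp
  then show ?thesis
    using that by linarith
qed

text \<open>Every counted r divides |n - m|, written with \<open>max\<close> and \<open>min\<close>
  because subtraction on naturals truncates. As n and m differ, this number is positive and has
  finitely many divisors.\<close>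

lemma sum_dyadic_cong_le_divisor_tau:
  assumes "n \<noteq> m"
  shows "(\<Sum>r\<in>dyadic R. of_bool ([n = m] (mod r))) \<le> real (divisor_tau (max n m - min n m))"
proof -
  have "(\<Sum>r\<in>dyadic R. of_bool ([n = m] (mod r))) = real (card {r \<in> dyadic R. [n = m] (mod r)})"
    by (simp add: finite_dyadic of_bool_def sum.If_cases Int_def)
  also have "card {r \<in> dyadic R. [n = m] (mod r)} \<le> card {d. d dvd max n m - min n m}"
  proof (rule card_mono)
    show "finite {d. d dvd max n m - min n m}"
      using assms by (intro finite_divisors_nat) auto
    have "r dvd max n m - min n m" if "[n = m] (mod r)" for r
      using that cong_altdef_nat[of n m r] cong_altdef_nat[of m n r] cong_sym[OF that]
      by (cases "n \<le> m") (simp_all add: max_def min_def)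
    then show "{r \<in> dyadic R. [n = m] (mod r)} \<subseteq> {d. d dvd max n m - min n m}"
      by blast
  qed
  finally show ?thesis
    by (simp add: divisor_tau_def)
qed

text \<open>E majorizes both \<open>\<beta>\<close> and tau on {1..Y}. On the diagonal, one factor
  \<open>\<beta> n\<close> is replaced by E and the moduli number at most 2 R. Off it, |n - m| lies
  in {1..Y}, so at most E moduli count each pair.\<close>

lemma sum_dyadic_discrepancy_squares_le:
  assumes R: "0 < R" and \<beta>0: "\<And>n. 0 \<le> \<beta> n"
    and supp: "\<And>n. 0 < n \<Longrightarrow> \<beta> n \<noteq> 0 \<Longrightarrow> n \<le> Y"
    and \<beta>_le: "\<And>n. n \<in> {1..Y} \<Longrightarrow> \<beta> n \<le> E"
    and tau_le: "\<And>n. n \<in> {1..Y} \<Longrightarrow> real (divisor_tau n) \<le> E"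
    and S: "S = (\<Sum>n\<in>{1..Y}. \<beta> n)"
  shows "(\<Sum>r\<in>dyadic R. \<Sum>a | a \<in> {1..r} \<and> coprime a r. (discrepancy \<beta> q r a)\<^sup>2)
    \<le> E * (2 * R * S + S\<^sup>2)"
proof -
  have "(\<Sum>r\<in>dyadic R. \<Sum>a | a \<in> {1..r} \<and> coprime a r. (discrepancy \<beta> q r a)\<^sup>2)
     \<le> (\<Sum>r\<in>dyadic R. \<Sum>n\<in>{1..Y}. \<Sum>m\<in>{1..Y}. \<beta> n * \<beta> m * of_bool ([n = m] (mod r)))"
  proof (intro sum_mono sum_discrepancy_squares_le \<beta>0 supp)
    fix r assume "r \<in> dyadic R"
    then show "0 < r" using R by (auto simp: dyadic_def intro: gr0I)
  qed
  also have "\<dots> = (\<Sum>n\<in>{1..Y}. \<Sum>m\<in>{1..Y}. \<beta> n * \<beta> m * (\<Sum>r\<in>dyadic R. of_bool ([n = m] (mod r))))"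
    by (subst sum.swap, rule sum.cong[OF refl], subst sum.swap) (simp only: sum_distrib_left)
  also have "\<dots> \<le> (\<Sum>n\<in>{1..Y}. \<Sum>m\<in>{1..Y}.
      (if n = m then \<beta> n * E * (2 * R) else 0) + \<beta> n * \<beta> m * E)"
  proof (intro sum_mono)
    fix n m assume nm: "n \<in> {1..Y}" "m \<in> {1..Y}"
    have E: "0 \<le> E" using \<beta>0[of n] \<beta>_le[OF nm(1)] by linarith
    show "\<beta> n * \<beta> m * (\<Sum>r\<in>dyadic R. of_bool ([n = m] (mod r)))
      \<le> (if n = m then \<beta> n * E * (2 * R) else 0) + \<beta> n * \<beta> m * E"
    proof (cases "n = m")
      case True
      have "\<beta> n * \<beta> n * real (card (dyadic R)) \<le> \<beta> n * E * (2 * R)"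
        using card_dyadic_le[OF R] \<beta>0 \<beta>_le[OF nm(1)] E by (intro mult_mono mult_left_mono) auto
      moreover have "0 \<le> \<beta> n * \<beta> n * E" using \<beta>0 E by auto
      ultimately show ?thesis using True by simp
    next
      case False
      have "(\<Sum>r\<in>dyadic R. of_bool ([n = m] (mod r))) \<le> real (divisor_tau (max n m - min n m))"
        using False by (rule sum_dyadic_cong_le_divisor_tau)
      also have "\<dots> \<le> E"
        using False nm by (intro tau_le) (auto simp: max_def min_def)
      finally show ?thesis
        using False \<beta>0 by (auto intro!: mult_left_mono)
    qed
  qed
  also have "\<dots> = E * (2 * R * S + S\<^sup>2)"
    by (simp add: sum.distrib S sum_distrib_left sum_distrib_right power2_eq_square sum_product
        algebra_simps)
  finally show ?thesis .
qed

section \<open>Choice of parameters and comparison of exponents\<close>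

theorem lemma3p9:
  "\<exists>B::real. 0 < B \<and>
    (\<forall>(L::nat) (K::real). 1 \<le> L \<longrightarrow> 0 < K \<longrightarrow>
      (\<exists>(C::real) (X0::real). 0 < C \<and> 1 \<le> X0 \<and>
        (\<forall>(X::real) (\<rho>::real) (Nj::nat \<Rightarrow> real) (js::nat list) (N::real) (\<beta>::nat \<Rightarrow> real) (R::real) (q::nat).
          X0 \<le> X \<longrightarrow>
          \<rho> = X powr (-varpi) \<longrightarrow>
          length js = L \<longrightarrow>
          (\<forall>j\<in>set js. 0 < Nj j) \<longrightarrow>
          N = (\<Prod>j\<leftarrow>js. Nj j) \<longrightarrow>
          \<beta> = dconv_list (map (\<lambda>j. interval_char \<rho> (Nj j)) js) \<longrightarrow>
          X powr (3/8 + 8 * varpi) < N \<longrightarrow>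
          N \<le> K * X powr (1/2) \<longrightarrow>
          R \<le> X powr (-varpi/6) * N \<longrightarrow>
          1 \<le> q \<longrightarrow>
          (\<Sum>r\<in>dyadic R. \<Sum>a | a \<in> {1..r} \<and> coprime a r. (discrepancy \<beta> q r a)\<^sup>2)
            \<le> C * (real (divisor_tau q) powr B * N\<^sup>2 * X powr (-varpi/12)))))"
proof (rule exI[of _ 1], intro conjI allI impI)
  fix L :: nat and K :: real
  assume L: "1 \<le> L" and K: "0 < K"
  have varpi: "0 < varpi" "varpi \<le> 1" by (auto simp: varpi_def)
  \<comment> \<open>The exponent varpi/L is chosen because \<open>\<beta>\<close> is bounded by
    tau^L: for n of size at most a constant times X^(1/2), tau(n)^L is then O(X^(varpi/2)).\<close>
  have "0 < varpi / L" "varpi / L \<le> 1"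
    using varpi L by (auto simp: field_simps)
  from divisor_bound[OF this] obtain c where c: "1 \<le> c"
      and tau: "\<And>n. 0 < n \<Longrightarrow> real (divisor_tau n) \<le> c * n powr (varpi / L)"
    by blast
  \<comment> \<open>\<open>c ^ L\<close> comes from the divisor bound, and the other factor from n
    <= 2^L K X^(1/2) on the support of \<open>\<beta>\<close>.\<close>
  define D where "D = c ^ L * (2 ^ L * K) powr varpi"
  have D: "0 < D" using c K by (simp add: D_def)
  show "\<exists>(C::real) (X0::real). 0 < C \<and> 1 \<le> X0 \<and>
        (\<forall>(X::real) (\<rho>::real) (Nj::nat \<Rightarrow> real) (js::nat list) (N::real) (\<beta>::nat \<Rightarrow> real) (R::real) (q::nat).
          X0 \<le> X \<longrightarrow>
          \<rho> = X powr (-varpi) \<longrightarrow>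
          length js = L \<longrightarrow>
          (\<forall>j\<in>set js. 0 < Nj j) \<longrightarrow>
          N = (\<Prod>j\<leftarrow>js. Nj j) \<longrightarrow>
          \<beta> = dconv_list (map (\<lambda>j. interval_char \<rho> (Nj j)) js) \<longrightarrow>
          X powr (3/8 + 8 * varpi) < N \<longrightarrow>
          N \<le> K * X powr (1/2) \<longrightarrow>
          R \<le> X powr (-varpi/6) * N \<longrightarrow>
          1 \<le> q \<longrightarrow>
          (\<Sum>r\<in>dyadic R. \<Sum>a | a \<in> {1..r} \<and> coprime a r. (discrepancy \<beta> q r a)\<^sup>2)
            \<le> C * (real (divisor_tau q) powr 1 * N\<^sup>2 * X powr (-varpi/12)))"
  \<comment> \<open>The summand 2 * 3^L comes from the diagonal term 2 R S and 9^L from S^2, where S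
    <= 3^L \<open>\<rho>\<close> N.\<close>
  proof (rule exI[of _ "D * (2 * 3 ^ L + 9 ^ L)"], rule exI[of _ 1], intro conjI allI impI)
    show "0 < D * (2 * 3 ^ L + 9 ^ L)"
      using D by (simp add: add_pos_pos)
    fix X \<rho> :: real and Nj :: "nat \<Rightarrow> real" and js :: "nat list" and N :: real
      and \<beta> :: "nat \<Rightarrow> real" and R :: real and q :: nat
    assume X: "1 \<le> X" and \<rho>: "\<rho> = X powr (-varpi)" and len: "length js = L"
      and Nj: "\<forall>j\<in>set js. 0 < Nj j" and N: "N = (\<Prod>j\<leftarrow>js. Nj j)"
      and \<beta>: "\<beta> = dconv_list (map (\<lambda>j. interval_char \<rho> (Nj j)) js)"
      and N_gt: "X powr (3/8 + 8 * varpi) < N" and N_le: "N \<le> K * X powr (1/2)"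
      and R: "R \<le> X powr (-varpi/6) * N" and q: "1 \<le> q"
    define Ms where "Ms = map Nj js"
    have Ms: "length Ms = L" "prod_list Ms = N" "\<beta> = dconv_list (map (interval_char \<rho>) Ms)"
        "\<And>M. M \<in> set Ms \<Longrightarrow> 0 < M"
      using len N \<beta> Nj by (auto simp: Ms_def comp_def)
    have \<rho>01: "0 < \<rho>" "\<rho> \<le> 1"
      using X varpi powr_mono[of "-varpi" 0 X] by (auto simp: \<rho>)
    have N0: "0 < N"
      using N_gt powr_ge_zero[of X "3/8 + 8 * varpi"] by linarith
    \<comment> \<open>The lower bound on N ensures \<open>\<rho>\<close> N >= 1, which is what the
      saving of \<open>\<rho>\<close> in the total mass requires.\<close>
    have "1 \<le> X powr (3/8 + 7 * varpi)"
      using X varpi by (intro ge_one_powr_ge_zero) auto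
    also have "\<dots> = \<rho> * X powr (3/8 + 8 * varpi)"
      by (simp add: \<rho> add.commute flip: powr_add)
    also have "\<dots> \<le> \<rho> * N"
      using N_gt \<rho>01 by (intro mult_left_mono) auto
    finally have \<rho>N: "1 \<le> \<rho> * N" .
    define Y where "Y = nat \<lfloor>2 ^ L * N\<rfloor>"
    define E where "E = D * X powr (varpi / 2)"
    define S where "S = (\<Sum>n\<in>{1..Y}. \<beta> n)"
    have \<beta>0: "0 \<le> \<beta> n" for n
      unfolding Ms by (intro dconv_list_nonneg) (auto simp: interval_char_bounds)
    have supp: "n \<le> Y" if "0 < n" "\<beta> n \<noteq> 0" for n
    proof -
      have "real n \<le> 2 ^ L * N"
        using dconv_list_interval_char_support[of \<rho> Ms n] that \<rho>01 Ms by simp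
      then show ?thesis by (simp add: Y_def le_nat_iff le_floor_iff)
    qed
    have tau_pow: "real (divisor_tau n) ^ L \<le> E" if "n \<in> {1..Y}" for n
    proof -
      have n: "0 < n" using that by simp
      have "real n \<le> real Y" using that by simp
      also have "real Y \<le> 2 ^ L * N"
        using N0 by (simp add: Y_def)
      also have "\<dots> \<le> 2 ^ L * (K * X powr (1/2))"
        using N_le by (intro mult_left_mono) auto
      finally have n_le: "real n \<le> (2 ^ L * K) * X powr (1/2)" by (simp add: mult_ac)
      have "real (divisor_tau n) ^ L \<le> (c * n powr (varpi / L)) ^ L"
        using tau[OF n] by (intro power_mono) auto
      also have "\<dots> = c ^ L * n powr varpi"
        using n L by (simp add: power_mult_distrib powr_power)
      also have "\<dots> \<le> c ^ L * ((2 ^ L * K) * X powr (1/2)) powr varpi"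
        using n_le c varpi by (intro mult_left_mono powr_mono2) auto
      also have "\<dots> = E"
        using K by (simp add: E_def D_def powr_mult powr_powr)
      finally show ?thesis .
    qed
    have tau_le: "real (divisor_tau n) \<le> E" if "n \<in> {1..Y}" for n
    proof -
      have "1 \<le> real (divisor_tau n)"
        using divisor_tau_pos[of n] that by simp
      then have "real (divisor_tau n) \<le> real (divisor_tau n) ^ L"
        using power_increasing[of 1 L "real (divisor_tau n)"] L by simp
      with tau_pow[OF that] show ?thesis by linarith
    qed
    have \<beta>_le: "\<beta> n \<le> E" if "n \<in> {1..Y}" for n
    proof -
      have "\<beta> n \<le> real (divisor_tau n) ^ length (map (interval_char \<rho>) Ms)"
        unfolding Ms using that
        by (intro dconv_list_le_divisor_tau_power) (auto simp: interval_char_bounds)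
      with tau_pow[OF that] Ms(1) show ?thesis by simp
    qed
    have S0: "0 \<le> S"
      unfolding S_def by (intro sum_nonneg \<beta>0)
    have "S \<le> (\<Prod>M\<leftarrow>Ms. \<Sum>n\<in>{1..Y}. interval_char \<rho> M n)"
    proof -
      have "S \<le> (\<Prod>f\<leftarrow>map (interval_char \<rho>) Ms. \<Sum>n\<in>{1..Y}. f n)"
        unfolding S_def Ms by (intro sum_dconv_list_le) (auto simp: interval_char_bounds)
      then show ?thesis by (simp add: comp_def)
    qed
    also have "\<dots> \<le> 3 ^ L * (\<rho> * N)"
      using prod_list_sum_interval_char_le[of Ms \<rho> Y] Ms \<rho>01 \<rho>N by simp
    finally have S_le: "S \<le> 3 ^ L * (X powr (-varpi) * N)" by (simp add: \<rho>)
    have E0: "0 \<le> E" using D by (simp add: E_def)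
    let ?Z = "N\<^sup>2 * X powr (-varpi/12)"
    have Z: "(\<Sum>r\<in>dyadic R. \<Sum>a | a \<in> {1..r} \<and> coprime a r. (discrepancy \<beta> q r a)\<^sup>2)
        \<le> D * (2 * 3 ^ L + 9 ^ L) * ?Z"
    proof (cases "0 < R")
      case False
      then have "dyadic R = {}" by (auto simp: dyadic_def)
      then show ?thesis using D by simp
    next
      case True
      have RS: "R * S \<le> (X powr (-varpi/6) * N) * (3 ^ L * (X powr (-varpi) * N))"
        using R S_le S0 N0 by (intro mult_mono) auto
      have SS: "S\<^sup>2 \<le> (3 ^ L * (X powr (-varpi) * N))\<^sup>2"
        using S_le S0 by (intro power_mono) auto
      have "X powr (varpi / 2) * (R * S) \<le>
          X powr (varpi / 2) * ((X powr (-varpi/6) * N) * (3 ^ L * (X powr (-varpi) * N)))"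
        using RS by (rule mult_left_mono) simp
      also have "\<dots> = 3 ^ L * N\<^sup>2 * X powr (varpi / 2 + (-varpi/6) + (-varpi))"
        by (simp only: powr_add power2_eq_square mult_ac)
      \<comment> \<open>In units of varpi the exponent is 1/2 - 1/6 - 1 = -2/3, below -1/12.\<close>
      also have "\<dots> \<le> 3 ^ L * N\<^sup>2 * X powr (-varpi/12)"
        using X varpi by (intro mult_left_mono powr_mono) auto
      finally have 1: "X powr (varpi / 2) * (R * S) \<le> 3 ^ L * ?Z" by (simp add: mult_ac)
      have "X powr (varpi / 2) * S\<^sup>2 \<le> X powr (varpi / 2) * (3 ^ L * (X powr (-varpi) * N))\<^sup>2"
        using SS by (rule mult_left_mono) simp
      also have "\<dots> = (3 ^ L * 3 ^ L) * N\<^sup>2 * X powr (varpi / 2 + (-varpi) + (-varpi))"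
        by (simp only: powr_add power2_eq_square mult_ac)
      also have "(3::real) ^ L * 3 ^ L = 9 ^ L"
        by (simp flip: power_mult_distrib)
      \<comment> \<open>Here the exponent is 1/2 - 2 = -3/2 in units of varpi.\<close>
      also have "9 ^ L * N\<^sup>2 * X powr (varpi / 2 + (-varpi) + (-varpi)) \<le> 9 ^ L * N\<^sup>2 * X powr (-varpi/12)"
        using X varpi by (intro mult_left_mono powr_mono) auto
      finally have 2: "X powr (varpi / 2) * S\<^sup>2 \<le> 9 ^ L * ?Z" by (simp add: mult_ac)
      have "(\<Sum>r\<in>dyadic R. \<Sum>a | a \<in> {1..r} \<and> coprime a r. (discrepancy \<beta> q r a)\<^sup>2)
          \<le> E * (2 * R * S + S\<^sup>2)"
        using True \<beta>0 supp \<beta>_le tau_le S_def by (rule sum_dyadic_discrepancy_squares_le)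
      also have "\<dots> = D * (2 * (X powr (varpi / 2) * (R * S)) + X powr (varpi / 2) * S\<^sup>2)"
        by (simp add: E_def algebra_simps)
      also have "\<dots> \<le> D * (2 * (3 ^ L * ?Z) + 9 ^ L * ?Z)"
        using 1 2 D by (intro mult_left_mono add_mono) auto
      finally show ?thesis by (simp add: algebra_simps)
    qed
    \<comment> \<open>The bound so far is uniform in q; the factor tau(q) >= 1 is inserted
      here.\<close>
    also have "\<dots> \<le> D * (2 * 3 ^ L + 9 ^ L) * (real (divisor_tau q) * ?Z)"
    proof -
      have "1 \<le> real (divisor_tau q)"
        using divisor_tau_pos[of q] q by simp
      then have "1 * ?Z \<le> real (divisor_tau q) * ?Z"
        by (intro mult_right_mono) auto
      then show ?thesis using D by (intro mult_left_mono) auto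
    qed
    finally show "(\<Sum>r\<in>dyadic R. \<Sum>a | a \<in> {1..r} \<and> coprime a r. (discrepancy \<beta> q r a)\<^sup>2)
        \<le> D * (2 * 3 ^ L + 9 ^ L) * (real (divisor_tau q) powr 1 * N\<^sup>2 * X powr (-varpi/12))"
      by (simp add: mult_ac)
  qed auto
qed auto

end
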